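(* For every integer $n\ge 1$, the $n\times n$ matrices $\bigl(c(i,j,q)\bigr)_{i,j=0}^{n-1}$ and $\bigl(b(i,j,q)(-1)^{\frac{i-j}{2}}\bigr)_{i,j=0}^{n-1}$ are mutually inverse.
   Context: $x,s,q$ are indeterminates, and $[n]_q=\frac{1-q^n}{1-q}$. The new $q$-Hermite polynomials are $H_n(x,s|q):=\mathcal{F}(z^n)$, where $\mathcal{F}$ is the linear functional on polynomials in $z$ determined by $\mathcal{F}(P_n(z))=\delta_{n,0}$ for all $n\ge0$, with $P_{-1}=0$, $P_0=1$, $P_{n+1}(z)=(z-xq^n)P_n(z)+s[n]_qP_{n-1}(z)$. The numbers $c(n,k,q)$ are the coefficients in $H_n(x,s|q)=\sum_{k}c(n,k,q)\,x^k(-s)^{\frac{n-k}{2}}$. The continuous $q$-Hermite polynomials $\tilde H_n(x,s|q)$ are defined by $\tilde H_{-1}=0$, $\tilde H_0=1$, $\tilde H_{n+1}(x,s|q)=x\tilde H_n(x,s|q)-s[n]_q\tilde H_{n-1}(x,s|q)$. The numbers $b(n,k,q)$ are the coefficients in $\tilde H_n(x,s|q)=\sum_k b(n,k,q)\,x^k(-s)^{\frac{n-k}{2}}$. In both expansions the sum is over $0\le k\le n$ with $k\equiv n \pmod 2$. The coefficients $c(n,k,q)$ and $b(n,k,q)$ are zero for all other $k$, so matrix entries with $i-j$ odd or $j>i$ are $0$. *)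

theory Defs
  imports "HOL-Computational_Algebra.Computational_Algebra" "Jordan_Normal_Form.Matrix"
begin

hide_const (open) module.smult

(* The indeterminate q lives in the field K(q) = 'a poly fract over an arbitrary field K = 'a,
   and s, x are polynomial indeterminates over it: the ring K(q)[s][x] is 'a poly fract poly poly
   (x outermost, then s).  Polynomials in z form one further layer. *)

type_synonym 'a qfield = "'a poly fract"
type_synonym 'a xsring = "'a poly fract poly poly"

definition qv :: "'a::field qfield" where
  "qv = Fract [:0, 1:] 1"

definition qint :: "nat \<Rightarrow> 'a::field qfield" where
  "qint n = (1 - qv ^ n) / (1 - qv)"

definition emb :: "'a::field qfield \<Rightarrow> 'a xsring" where
  "emb a = [:[:a:]:]"

definition xv :: "'a::field xsring" where
  "xv = [:0, 1:]"

definition sv :: "'a::field xsring" where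
  "sv = [:[:0, 1:]:]"

definition zv :: "'a::field xsring poly" where
  "zv = [:0, 1:]"

(* The recursion starts from the value 0 at index -1, so that term is absent from the second equation. *)
fun P :: "nat \<Rightarrow> 'a::field xsring poly" where
  "P 0 = 1"
| "P (Suc 0) = zv - [:xv:]"
| "P (Suc (Suc n)) = (zv - [:xv * emb (qv ^ Suc n):]) * P (Suc n) + smult (sv * emb (qint (Suc n))) (P n)"

definition is_functional :: "('a::field xsring poly \<Rightarrow> 'a xsring) \<Rightarrow> bool" where
  "is_functional L \<longleftrightarrow> module_hom smult (*) L \<and> (\<forall>n. L (P n) = (if n = 0 then 1 else 0))"

definition functional :: "'a::field xsring poly \<Rightarrow> 'a xsring" where
  "functional = (THE L. is_functional L)"

definition new_q_hermite :: "nat \<Rightarrow> 'a::field xsring" where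
  "new_q_hermite n = functional (zv ^ n)"

fun cont_q_hermite :: "nat \<Rightarrow> 'a::field xsring" where
  "cont_q_hermite 0 = 1"
| "cont_q_hermite (Suc 0) = xv"
| "cont_q_hermite (Suc (Suc n)) =
     xv * cont_q_hermite (Suc n) - sv * emb (qint (Suc n)) * cont_q_hermite n"

definition has_coeffs :: "(nat \<Rightarrow> 'a::field xsring) \<Rightarrow> (nat \<Rightarrow> nat \<Rightarrow> 'a qfield) \<Rightarrow> bool" where
  "has_coeffs f a \<longleftrightarrow>
     (\<forall>n. f n = (\<Sum>k | k \<le> n \<and> even (n - k). emb (a n k) * xv ^ k * (- sv) ^ ((n - k) div 2))) \<and>
     (\<forall>n k. \<not> (k \<le> n \<and> even (n - k)) \<longrightarrow> a n k = 0)"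

definition c_coeff :: "nat \<Rightarrow> nat \<Rightarrow> 'a::field qfield" where
  "c_coeff = (THE a. has_coeffs new_q_hermite a)"

definition b_coeff :: "nat \<Rightarrow> nat \<Rightarrow> 'a::field qfield" where
  "b_coeff = (THE a. has_coeffs cont_q_hermite a)"

(* All three definite descriptions above are proper: see functional_ex1, has_coeffs_c, has_coeffs_b. *)

lemma P_monic: "degree (P n :: 'a::field xsring poly) = n \<and> coeff (P n :: 'a xsring poly) n = 1"
proof (induction n rule: P.induct)
  case (3 n)
  have e: "(zv - [:xv * emb (qv ^ Suc n):]) = [:- (xv * emb (qv ^ Suc n)), 1::'a xsring:]"
    by (simp add: zv_def)
  have l: "lead_coeff (P (Suc n)) = (1::'a xsring)" and nz: "P (Suc n) \<noteq> (0::'a xsring poly)"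
    using 3 by auto
  have d: "degree ([:- (xv * emb (qv ^ Suc n)), 1:] * P (Suc n) :: 'a xsring poly) = Suc (Suc n)"
    using 3 nz by (subst degree_mult_eq) auto
  have cf: "coeff ([:- (xv * emb (qv ^ Suc n)), 1:] * P (Suc n) :: 'a xsring poly) (Suc (Suc n)) = 1"
    using 3 by (simp add: coeff_eq_0)
  have d2: "degree (smult (sv * emb (qint (Suc n))) (P n) :: 'a xsring poly) < Suc (Suc n)"
    using 3 by (metis degree_smult_le le_imp_less_Suc less_SucI)
  have "coeff (P n) (Suc (Suc n)) = (0::'a xsring)"
    using 3 by (simp add: coeff_eq_0)
  then show ?case
    unfolding P.simps e using d d2 cf
    by (simp add: degree_add_eq_left coeff_eq_0 del: mult_pCons_left)
qed (auto simp: zv_def)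

fun mom :: "nat \<Rightarrow> 'a::field xsring" where
  "mom n = (if n = 0 then 1 else 0) - (\<Sum>k<n. coeff (P n) k * mom k)"

declare mom.simps [simp del]

lemma functional_unique:
  fixes L :: "'a::field xsring poly \<Rightarrow> 'a xsring"
  assumes "is_functional L"
  shows "L p = (\<Sum>k\<le>degree p. coeff p k * mom k)"
proof -
  interpret module_hom smult "(*)" L using assms by (simp add: is_functional_def)
  have expand: "L p = (\<Sum>k\<le>degree p. coeff p k * L (monom 1 k))" for p
  proof -
    have "L p = L (\<Sum>k\<le>degree p. smult (coeff p k) (monom 1 k))"
      by (simp add: smult_monom poly_as_sum_of_monoms)
    then show ?thesis by (simp add: sum scale)
  qed
  have m: "L (monom 1 n) = mom n" for n
  proof (induction n rule: less_induct)
    case (less n)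
    have "(if n = 0 then 1 else 0) = L (P n)" using assms by (simp add: is_functional_def)
    also have "\<dots> = (\<Sum>k<n. coeff (P n) k * L (monom 1 k)) + L (monom 1 n)"
      using P_monic[of n, where 'a='a] by (subst expand) (simp add: lessThan_Suc flip: lessThan_Suc_atMost)
    finally show ?case using less by (subst mom.simps) (simp add: algebra_simps)
  qed
  show ?thesis by (subst expand) (simp add: m)
qed

lemma functional_exists: "is_functional (\<lambda>p. \<Sum>k\<le>degree p. coeff p k * mom k)"
proof -
  let ?L = "\<lambda>p :: 'a xsring poly. \<Sum>k\<le>degree p. coeff p k * mom k"
  have bound: "?L p = (\<Sum>k\<le>N. coeff p k * mom k)" if "degree p \<le> N" for p N
    using that by (intro sum.mono_neutral_left) (auto simp: coeff_eq_0)
  have add: "?L (p + r) = ?L p + ?L r" for p r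
    using bound[of p "max (degree p) (degree r)"] bound[of r "max (degree p) (degree r)"]
      bound[of "p + r" "max (degree p) (degree r)"] degree_add_le_max[of p r]
    by (simp add: algebra_simps sum.distrib)
  have scale: "?L (smult a p) = a * ?L p" for a p
    using bound[of "smult a p" "degree p"] degree_smult_le[of a p]
    by (simp add: sum_distrib_left mult.assoc)
  have "?L (P n) = (if n = 0 then 1 else 0)" for n
  proof -
    have "?L (P n) = (\<Sum>k<n. coeff (P n) k * mom k) + mom n"
      using P_monic[of n, where 'a='a] by (simp flip: lessThan_Suc_atMost)
    then show ?thesis by (subst (asm) (2) mom.simps) simp
  qed
  moreover have "module_hom smult (*) ?L"
    by unfold_locales (rule add scale | simp add: algebra_simps smult_add_right smult_add_left)+
  ultimately show ?thesis by (simp add: is_functional_def)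
qed

lemma functional_ex1: "\<exists>!L. is_functional L"
  using functional_exists functional_unique by (intro ex1I) (auto intro!: ext)

lemma is_functional_functional: "is_functional functional"
  unfolding functional_def by (rule theI'[OF functional_ex1])

lemma zv_power: "zv ^ n = monom 1 n"
  by (simp add: zv_def monom_altdef)

lemma new_q_hermite_eq_mom: "new_q_hermite n = (mom n :: 'a::field xsring)"
proof -
  have "new_q_hermite n = (\<Sum>k\<le>n. coeff (monom 1 n) k * mom k :: 'a::field xsring)"
    by (simp add: new_q_hermite_def functional_unique[OF is_functional_functional] zv_power
        degree_monom_eq)
  also have "\<dots> = (\<Sum>k\<le>n. if k = n then mom k else 0)"
    by (intro sum.cong) auto
  finally show ?thesis by simp
qed

text \<open>Homogeneity for the grading in which x has weight 1 and s has weight 2.\<close>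

definition homog :: "nat \<Rightarrow> 'a::field xsring \<Rightarrow> bool" where
  "homog m p \<longleftrightarrow> (\<forall>i j. coeff (coeff p i) j \<noteq> 0 \<longrightarrow> i + 2 * j = m)"

lemma homog_0: "homog m 0"
  by (simp add: homog_def)

lemma homog_1: "homog 0 1"
  by (auto simp: homog_def coeff_1 split: if_splits)

lemma homog_emb: "homog 0 (emb a)"
  by (auto simp: homog_def emb_def coeff_pCons split: nat.splits)

lemma homog_xv: "homog 1 xv"
  by (auto simp: homog_def xv_def coeff_pCons coeff_1 split: nat.splits if_splits)

lemma homog_sv: "homog 2 sv"
  by (auto simp: homog_def sv_def coeff_pCons coeff_1 split: nat.splits if_splits)

lemma homog_add: "homog m p \<Longrightarrow> homog m r \<Longrightarrow> homog m (p + r)"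
proof -
  assume *: "homog m p" "homog m r"
  have "coeff (coeff (p + r) i) j = 0" if "i + 2 * j \<noteq> m" for i j
  proof -
    have "coeff (coeff p i) j = 0" "coeff (coeff r i) j = 0"
      using * that unfolding homog_def by blast+
    then show ?thesis by simp
  qed
  then show ?thesis unfolding homog_def by blast
qed

lemma homog_diff: "homog m p \<Longrightarrow> homog m r \<Longrightarrow> homog m (p - r)"
proof -
  assume *: "homog m p" "homog m r"
  have "coeff (coeff (p - r) i) j = 0" if "i + 2 * j \<noteq> m" for i j
  proof -
    have "coeff (coeff p i) j = 0" "coeff (coeff r i) j = 0"
      using * that unfolding homog_def by blast+
    then show ?thesis by simp
  qed
  then show ?thesis unfolding homog_def by blast
qed

lemma homog_sum: "(\<And>k. k \<in> A \<Longrightarrow> homog m (f k)) \<Longrightarrow> homog m (sum f A)"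
  by (induction A rule: infinite_finite_induct) (auto simp: homog_0 homog_add)

lemma homog_mult:
  assumes "homog m p" "homog n r"
  shows "homog (m + n) (p * r)"
  unfolding homog_def
proof (intro allI impI)
  fix i j
  assume "coeff (coeff (p * r) i) j \<noteq> 0"
  then have "(\<Sum>a\<le>i. \<Sum>d\<le>j. coeff (coeff p a) d * coeff (coeff r (i - a)) (j - d)) \<noteq> 0"
    by (simp add: coeff_mult coeff_sum)
  then obtain a where "a \<le> i" "(\<Sum>d\<le>j. coeff (coeff p a) d * coeff (coeff r (i - a)) (j - d)) \<noteq> 0"
    by (metis (no_types, lifting) atMost_iff sum.not_neutral_contains_not_neutral)
  moreover from this(2) obtain d where "d \<le> j" "coeff (coeff p a) d * coeff (coeff r (i - a)) (j - d) \<noteq> 0"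
    by (metis (no_types, lifting) atMost_iff sum.not_neutral_contains_not_neutral)
  ultimately have "a + 2 * d = m" "(i - a) + 2 * (j - d) = n" "a \<le> i" "d \<le> j"
    using assms by (auto simp: homog_def)
  then show "i + 2 * j = m + n" by simp
qed

lemma homog_P: "k \<le> n \<Longrightarrow> homog (n - k) (coeff (P n) k)"
proof (induction n arbitrary: k rule: P.induct)
  case 1
  then show ?case by (simp add: homog_1)
next
  case 2
  then show ?case
    using homog_diff[OF homog_0 homog_xv, where 'a='a]
    by (auto simp: zv_def homog_1 le_Suc_eq)
next
  case (3 n)
  let ?y = "xv * emb (qv ^ Suc n) :: 'a xsring"
  let ?w = "sv * emb (qint (Suc n)) :: 'a xsring"
  have y: "homog 1 ?y" using homog_mult[OF homog_xv homog_emb] by simp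
  have w: "homog 2 ?w" using homog_mult[OF homog_sv homog_emb] by simp
  have zero: "coeff (P m) i = (0::'a xsring)" if "m < i" for m i
    using P_monic[of m, where 'a='a] that by (simp add: coeff_eq_0)
  have eq: "coeff (P (Suc (Suc n))) k =
      (if k = 0 then 0 else coeff (P (Suc n)) (k - 1)) - ?y * coeff (P (Suc n)) k + ?w * coeff (P n) k"
    by (simp add: zv_def algebra_simps coeff_pCons split: nat.splits)
  have "homog (Suc (Suc n) - k) (if k = 0 then 0 else coeff (P (Suc n)) (k - 1) :: 'a xsring)"
    using "3.IH"(1)[of "k - 1"] "3.prems" by (auto simp: homog_0 Suc_diff_le)
  moreover have "homog (Suc (Suc n) - k) (?y * coeff (P (Suc n)) k)"
  proof (cases "k \<le> Suc n")
    case True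
    then show ?thesis using homog_mult[OF y "3.IH"(1)[of k]] by (simp add: Suc_diff_le)
  qed (simp add: zero homog_0)
  moreover have "homog (Suc (Suc n) - k) (?w * coeff (P n) k)"
  proof (cases "k \<le> n")
    case True
    then show ?thesis using homog_mult[OF w "3.IH"(2)[of k]] by (simp add: Suc_diff_le)
  qed (simp add: zero homog_0)
  ultimately show ?case unfolding eq by (intro homog_add homog_diff)
qed

lemma homog_mom: "homog n (mom n :: 'a::field xsring)"
proof (induction n rule: less_induct)
  case (less n)
  have "homog n (coeff (P n) k * mom k :: 'a xsring)" if "k < n" for k
    using homog_mult[OF homog_P[of k n] less[OF that]] that by simp
  moreover have "homog n (if n = 0 then 1 else 0 :: 'a xsring)"
    by (simp add: homog_0 homog_1)
  ultimately show ?case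
    by (subst mom.simps) (intro homog_diff homog_sum, simp_all)
qed

lemma homog_cont_q_hermite: "homog n (cont_q_hermite n)"
proof (induction n rule: cont_q_hermite.induct)
  case (3 n)
  have "homog (1 + Suc n) (xv * cont_q_hermite (Suc n) :: 'a xsring)"
    by (rule homog_mult[OF homog_xv 3(1)])
  moreover have "homog (2 + 0 + n) (sv * emb (qint (Suc n)) * cont_q_hermite n :: 'a xsring)"
    by (intro homog_mult homog_sv homog_emb 3(2))
  ultimately show ?case by (auto intro: homog_diff)
qed (use homog_1 homog_xv in auto)

lemma term_eq_monom: "emb a * xv ^ k * (- sv) ^ m = monom (monom ((-1) ^ m * a) m) k"
proof -
  have s: "(- sv) ^ m = [:monom ((-1) ^ m) m:]" for m
    by (induction m) (auto simp: sv_def one_pCons monom_Suc algebra_simps simp flip: minus_monom)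
  have "emb a * xv ^ k = monom [:a:] k"
    by (simp add: emb_def xv_def monom_altdef)
  then have "emb a * xv ^ k * (- sv) ^ m = smult (monom ((-1) ^ m) m) (monom [:a:] k)"
    by (simp add: s mult.commute)
  also have "\<dots> = monom (monom ((-1) ^ m * a) m) k"
    by (simp add: smult_monom mult.commute)
  finally show ?thesis .
qed

lemma coeff_expansion:
  "coeff (coeff (\<Sum>k | k \<le> n \<and> even (n - k). emb (a k) * xv ^ k * (- sv) ^ ((n - k) div 2)) i) j =
     (if i + 2 * j = n then (-1) ^ j * a i else 0)"
proof -
  have "coeff (coeff (\<Sum>k | k \<le> n \<and> even (n - k). emb (a k) * xv ^ k * (- sv) ^ ((n - k) div 2)) i) j =
     (\<Sum>k | k \<le> n \<and> even (n - k). if k = i then (if i + 2 * j = n then (-1) ^ j * a i else 0) else 0)"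
    unfolding coeff_sum term_eq_monom by (intro sum.cong) auto
  then show ?thesis by auto
qed

lemma has_coeffs_ex1:
  assumes "\<And>n. homog n (f n)"
  shows "\<exists>!a. has_coeffs f a"
proof (rule ex1I)
  let ?a = "\<lambda>n k. if k \<le> n \<and> even (n - k)
              then (-1) ^ ((n - k) div 2) * coeff (coeff (f n) k) ((n - k) div 2) else 0"
  have sq: "(-1) ^ j * ((-1) ^ j * u) = u" for j and u :: "'a qfield"
    by (simp add: left_minus_one_mult_self)
  have f: "coeff (coeff (f n) i) j = (if i + 2 * j = n then (-1) ^ j * ?a n i else 0)" for n i j
  proof (cases "i + 2 * j = n")
    case True
    then have "i \<le> n" "n - i = 2 * j" by auto
    then have "?a n i = (-1) ^ j * coeff (coeff (f n) i) j" by simp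
    with True show ?thesis by (simp add: sq)
  next
    case False
    with assms[of n] have "coeff (coeff (f n) i) j = 0" unfolding homog_def by blast
    with False show ?thesis by simp
  qed
  have "f n = (\<Sum>k | k \<le> n \<and> even (n - k). emb (?a n k) * xv ^ k * (- sv) ^ ((n - k) div 2))" for n
    by (rule poly_eqI, rule poly_eqI, subst coeff_expansion, rule f)
  then show "has_coeffs f ?a"
    unfolding has_coeffs_def by (intro conjI allI impI, assumption) (erule if_not_P)
next
  fix a
  assume a: "has_coeffs f a"
  show "a = (\<lambda>n k. if k \<le> n \<and> even (n - k)
              then (-1) ^ ((n - k) div 2) * coeff (coeff (f n) k) ((n - k) div 2) else 0)"
  proof (intro ext)
    fix n k
    have "f n = (\<Sum>k | k \<le> n \<and> even (n - k). emb (a n k) * xv ^ k * (- sv) ^ ((n - k) div 2))"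
      using a by (simp add: has_coeffs_def)
    then have "coeff (coeff (f n) k) j = (if k + 2 * j = n then (-1) ^ j * a n k else 0)" for j
      by (simp only: coeff_expansion)
    then show "a n k = (if k \<le> n \<and> even (n - k)
              then (-1) ^ ((n - k) div 2) * coeff (coeff (f n) k) ((n - k) div 2) else 0)"
      using a by (auto simp: has_coeffs_def simp flip: mult.assoc power_add)
  qed
qed

lemma has_coeffs_c: "has_coeffs new_q_hermite c_coeff"
  unfolding c_coeff_def by (rule theI'[OF has_coeffs_ex1]) (simp add: new_q_hermite_eq_mom homog_mom)

lemma has_coeffs_b: "has_coeffs cont_q_hermite b_coeff"
  unfolding b_coeff_def by (rule theI'[OF has_coeffs_ex1]) (rule homog_cont_q_hermite)

end

theory Submission
  imports Defs "Jordan_Normal_Form.Determinant"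
begin

text \<open>
  Replacing \<open>s\<close> by \<open>-s\<close> turns the recursion of the continuous \<open>q\<close>-Hermite polynomials into the
  recursion of the orthogonal polynomials \<open>P\<close> with \<open>x = 0\<close>.  Call the resulting polynomials in \<open>z\<close>
  \<open>h\<^sub>n\<close>; their coefficients are, up to powers of \<open>-s\<close>, exactly the entries
  \<open>\<beta>(n, k) = b(n, k) (-1)\<^bsup>(n - k)/2\<^esup>\<close> of the second matrix (lemma \<open>coeff_P_at_0\<close>).

  The parameter \<open>x\<close> is restored by the \<open>q\<close>-binomial theorem for these polynomials,
  \<open>h\<^sub>n = \<Sum>\<^sub>k [n choose k]\<^sub>q x\<^bsup>n-k\<^esup> P\<^sub>k\<close> (lemma \<open>P_at_0_expansion\<close>): in the three-term recursions the
  \<open>x\<close>-terms match by the \<open>q\<close>-Pascal rule, and the \<open>s\<close>-terms match by the absorption identity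
  \<open>[k+1] [n+1 choose k+1]\<^sub>q = [n+1] [n choose k]\<^sub>q\<close>.  The functional sees only the \<open>P\<^sub>0\<close>-component of
  this expansion, so it maps \<open>h\<^sub>n\<close> to \<open>x\<^sup>n\<close>.  As it also maps \<open>z\<^sup>k\<close> to \<open>H\<^sub>k\<close>, applying it to \<open>h\<^sub>n\<close>
  coefficientwise yields
  \<open>\<Sum>\<^sub>k \<beta>(n, k) (-s)\<^bsup>(n - k)/2\<^esup> H\<^sub>k = x\<^sup>n\<close> (lemma \<open>new_q_hermite_inversion\<close>).

  Expanding each \<open>H\<^sub>k\<close> here exhibits the product of the two matrices as the array of coefficients of
  \<open>x\<^sup>n\<close>, which is the identity because such arrays are unique.  A one-sided inverse of a square matrix
  over a field is two-sided.
\<close>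

hide_const (open) module.smult

section \<open>Gaussian binomial coefficients\<close>

lemma qv_neq_1: "qv \<noteq> (1 :: 'a::field qfield)"
  by (simp add: qv_def One_fract_def eq_fract one_pCons)

lemma qint_0: "qint 0 = 0"
  by (simp add: qint_def)

lemma qint_Suc: "qint (Suc n) = (1 + qv * qint n :: 'a::field qfield)"
proof -
  have "1 - qv ^ Suc n = (1 - qv) + qv * (1 - qv ^ n :: 'a qfield)"
    by (simp add: algebra_simps)
  then show ?thesis
    using qv_neq_1[where 'a = 'a] by (simp only: qint_def add_divide_distrib) simp
qed

fun qbinom :: "nat \<Rightarrow> nat \<Rightarrow> 'a::field qfield" where
  "qbinom n 0 = 1"
| "qbinom 0 (Suc k) = 0"
| "qbinom (Suc n) (Suc k) = qbinom n k + qv ^ Suc k * qbinom n (Suc k)"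

lemma qbinom_eq_0: "n < k \<Longrightarrow> qbinom n k = 0"
  by (induction n k rule: qbinom.induct) auto

text \<open>
  Writing \<open>[k+1] = 1 + q [k]\<close> after one Pascal step leaves two terms to which the identity for the
  previous row applies, at \<open>k - 1\<close> and at \<open>k\<close>; a Pascal step backwards recombines them.
\<close>

lemma qbinom_absorption:
  "qint (Suc k) * qbinom (Suc n) (Suc k) = (qint (Suc n) * qbinom n k :: 'a::field qfield)"
proof (induction n arbitrary: k)
  case 0
  show ?case by (cases k) (simp_all add: qint_Suc qint_0)
next
  case (Suc n)
  define l :: "'a qfield" where "l = (if k = 0 then 0 else qbinom n (k - 1))"
  have lower: "qint k * qbinom (Suc n) k = qint (Suc n) * l"
    using Suc.IH[of "k - 1"] by (cases k) (simp_all add: l_def qint_0 del: qbinom.simps(3))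
  have pascal: "qbinom (Suc n) k = l + qv ^ k * qbinom n k"
    by (cases k) (simp_all add: l_def)
  have "qint (Suc k) * qbinom (Suc (Suc n)) (Suc k)
      = qint (Suc k) * qbinom (Suc n) k + qv ^ Suc k * (qint (Suc k) * qbinom (Suc n) (Suc k) :: 'a qfield)"
    by (subst qbinom.simps(3)) (simp only: algebra_simps)
  also have "\<dots> = (1 + qv * qint k) * qbinom (Suc n) k + qv ^ Suc k * (qint (Suc n) * qbinom n k)"
    by (simp only: Suc.IH) (simp only: qint_Suc)
  also have "\<dots> = qbinom (Suc n) k + qv * (qint k * qbinom (Suc n) k)
      + qv ^ Suc k * (qint (Suc n) * qbinom n k)"
    by (simp only: distrib_right mult_1_left mult.assoc)
  also have "\<dots> = qbinom (Suc n) k + qv * qint (Suc n) * (l + qv ^ k * qbinom n k)"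
    by (simp only: lower) (simp only: distrib_left power_Suc ac_simps)
  also have "\<dots> = (1 + qv * qint (Suc n)) * qbinom (Suc n) k"
    by (simp only: pascal[symmetric] distrib_right mult_1_left)
  also have "\<dots> = qint (Suc (Suc n)) * qbinom (Suc n) k"
    by (simp only: qint_Suc[of "Suc n"])
  finally show ?case .
qed

section \<open>The orthogonal polynomials at \<open>x = 0\<close>\<close>

lemma emb_add: "emb (a + b) = emb a + emb b"
  by (simp add: emb_def)

lemma emb_mult: "emb (a * b) = emb a * emb b"
  by (simp add: emb_def)

lemma emb_0: "emb 0 = 0"
  by (simp add: emb_def)

lemma emb_1: "emb 1 = 1"
  by (simp add: emb_def one_pCons)

lemma emb_minus: "emb (- a) = - emb a"
  by (simp add: emb_def)

lemma emb_sum: "emb (sum f A) = (\<Sum>i\<in>A. emb (f i))"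
  by (induction A rule: infinite_finite_induct) (simp_all add: emb_0 emb_add)

lemma smult_sum_right: "smult c (sum p A) = (\<Sum>i\<in>A. smult c (p i))"
  by (induction A rule: infinite_finite_induct) (simp_all add: smult_add_right)

fun P_at_0 :: "nat \<Rightarrow> 'a::field xsring poly" where
  "P_at_0 0 = 1"
| "P_at_0 (Suc 0) = zv"
| "P_at_0 (Suc (Suc n)) = zv * P_at_0 (Suc n) + smult (sv * emb (qint (Suc n))) (P_at_0 n)"

text \<open>
  The recursion of \<open>P\<close>, read as multiplication by \<open>z\<close> in the basis of the \<open>P k\<close>.  For \<open>k = 0\<close> the
  index \<open>k - 1\<close> is harmless, since then \<open>qint k = 0\<close>.
\<close>

lemma zv_mult_P:
  "zv * P k = P (Suc k) + smult (xv * emb (qv ^ k)) (P k) - smult (sv * emb (qint k)) (P (k - 1))"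
  by (cases k) (simp_all add: emb_0 emb_1 qint_0 algebra_simps del: power_Suc)

text \<open>
  This is the \<open>q\<close>-binomial theorem that translates \<open>x = 0\<close> to general \<open>x\<close>.  The coefficients satisfy
  a Pascal rule, which absorbs the diagonal part \<open>x q\<^sup>k\<close> of multiplication by \<open>z\<close>, and the absorption
  identity, which makes the two \<open>s\<close>-terms cancel.
\<close>

lemma P_at_0_expansion:
  "P_at_0 n = (\<Sum>k\<le>n. smult (emb (qbinom n k) * xv ^ (n - k)) (P k) :: 'a::field xsring poly)"
proof (induction n rule: P_at_0.induct)
  case 1
  show ?case by (simp add: emb_1)
next
  case 2
  show ?case by (simp add: emb_1)
next
  case (3 n)
  define a :: "nat \<Rightarrow> nat \<Rightarrow> 'a xsring" where "a n k = emb (qbinom n k) * xv ^ (n - k)" for n k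
  have pascal_0: "a (Suc n) 0 = xv * emb (qv ^ 0) * a n 0" for n
    by (simp add: a_def emb_1)
  have pascal: "a (Suc n) (Suc k) = a n k + xv * emb (qv ^ Suc k) * a n (Suc k)" for n k
  proof (cases "Suc k \<le> n")
    case True
    then have "n - k = Suc (n - Suc k)" by simp
    then show ?thesis
      by (simp add: a_def emb_add emb_mult algebra_simps del: power_Suc) (simp add: algebra_simps)
  next
    case False
    then show ?thesis by (simp add: a_def qbinom_eq_0 emb_0)
  qed
  have absorb: "emb (qint (Suc k)) * a (Suc n) (Suc k) = emb (qint (Suc n)) * a n k" for k
    by (simp only: a_def mult.assoc[symmetric] emb_mult[symmetric] qbinom_absorption diff_Suc_Suc)
  have above: "a (Suc n) (Suc (Suc n)) = 0"
    by (simp add: a_def qbinom_eq_0 emb_0)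
  have "zv * P_at_0 (Suc n) = (\<Sum>k\<le>Suc n. smult (a (Suc n) k) (zv * P k))"
    by (simp only: 3 a_def sum_distrib_left mult_smult_right)
  also have "\<dots> = (\<Sum>k\<le>Suc n. smult (a (Suc n) k) (P (Suc k)))
      + (\<Sum>k\<le>Suc n. smult (xv * emb (qv ^ k) * a (Suc n) k) (P k))
      - (\<Sum>k\<le>Suc n. smult (sv * (emb (qint k) * a (Suc n) k)) (P (k - 1)))"
    unfolding zv_mult_P
    by (simp only: smult_add_right smult_diff_right smult_smult sum.distrib sum_subtractf mult_ac)
  also have "(\<Sum>k\<le>Suc n. smult (sv * (emb (qint k) * a (Suc n) k)) (P (k - 1)))
      = (\<Sum>k\<le>n. smult (sv * (emb (qint (Suc n)) * a n k)) (P k))"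
    by (subst sum.atMost_Suc_shift) (simp add: absorb qint_0 emb_0)
  also have "\<dots> = smult (sv * emb (qint (Suc n))) (P_at_0 n)"
    by (simp only: 3 a_def smult_sum_right smult_smult mult.assoc)
  also have "(\<Sum>k\<le>Suc n. smult (xv * emb (qv ^ k) * a (Suc n) k) (P k))
      = (\<Sum>k\<le>Suc (Suc n). smult (xv * emb (qv ^ k) * a (Suc n) k) (P k))"
    using above by simp
  also have "\<dots> = smult (a (Suc (Suc n)) 0) (P 0)
      + (\<Sum>k\<le>Suc n. smult (xv * emb (qv ^ Suc k) * a (Suc n) (Suc k)) (P (Suc k)))"
    by (subst sum.atMost_Suc_shift) (simp only: pascal_0)
  finally have "P_at_0 (Suc (Suc n)) = smult (a (Suc (Suc n)) 0) (P 0)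
      + (\<Sum>k\<le>Suc n. smult (a (Suc (Suc n)) (Suc k)) (P (Suc k)))"
    by (simp only: P_at_0.simps pascal[of "Suc n"] smult_add_left sum.distrib) simp
  then show ?case
    unfolding a_def[symmetric] by (subst sum.atMost_Suc_shift)
qed

lemma functional_sum_smult:
  "functional (\<Sum>k\<in>A. smult (r k) (p k)) = (\<Sum>k\<in>A. r k * functional (p k) :: 'a::field xsring)"
proof -
  interpret module_hom smult "(*)" "functional :: 'a xsring poly \<Rightarrow> 'a xsring"
    using is_functional_functional[where 'a = 'a] by (simp add: is_functional_def)
  show ?thesis by (simp add: sum scale)
qed

lemma functional_P_at_0: "functional (P_at_0 n) = (xv ^ n :: 'a::field xsring)"
proof -
  have "functional (P k) = (if k = 0 then 1 else 0 :: 'a xsring)" for k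
    using is_functional_functional[where 'a = 'a] by (simp add: is_functional_def del: P.simps)
  then have "functional (P_at_0 n)
      = (\<Sum>k\<le>n. if k = 0 then emb (qbinom n k) * xv ^ (n - k) else 0 :: 'a xsring)"
    unfolding P_at_0_expansion functional_sum_smult by (intro sum.cong) auto
  then show ?thesis by (simp add: emb_1)
qed

section \<open>Coefficients of the continuous \<open>q\<close>-Hermite polynomials\<close>

lemma coeff_cont_q_hermite:
  "coeff (coeff (cont_q_hermite n) i) j
     = (if i + 2 * j = n then (-1) ^ j * b_coeff n i else 0 :: 'a::field qfield)"
proof -
  have "(cont_q_hermite n :: 'a xsring)
      = (\<Sum>k | k \<le> n \<and> even (n - k). emb (b_coeff n k) * xv ^ k * (- sv) ^ ((n - k) div 2))"
    using has_coeffs_b unfolding has_coeffs_def by blast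
  then show ?thesis by (simp only: coeff_expansion)
qed

lemma b_coeff_eq_0: "\<not> (k \<le> n \<and> even (n - k)) \<Longrightarrow> b_coeff n k = 0"
  using has_coeffs_b unfolding has_coeffs_def by blast

lemma b_coeff_0: "b_coeff 0 k = (if k = 0 then 1 else 0)"
  using coeff_cont_q_hermite[of 0 0 0] by (auto simp: b_coeff_eq_0)

lemma b_coeff_1: "b_coeff (Suc 0) k = (if k = 1 then 1 else 0)"
proof (cases "k = 1")
  case True
  then show ?thesis using coeff_cont_q_hermite[of "Suc 0" 1 0] by (simp add: xv_def)
next
  case False
  then have "\<not> (k \<le> Suc 0 \<and> even (Suc 0 - k))" by (cases k) auto
  with False show ?thesis by (simp add: b_coeff_eq_0)
qed

lemma b_coeff_Suc_Suc:
  "b_coeff (Suc (Suc n)) k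
     = (if k = 0 then 0 else b_coeff (Suc n) (k - 1)) + qint (Suc n) * (b_coeff n k :: 'a::field qfield)"
proof (cases "k \<le> Suc (Suc n) \<and> even (Suc (Suc n) - k)")
  case True
  \<comment> \<open>Compare the coefficients of \<open>x\<^sup>k s\<^sup>j\<close> in the recursion; the minus sign in front of \<open>s\<close> there is
    absorbed by the sign \<open>(-1)\<^sup>j\<close> that the powers of \<open>-s\<close> contribute.\<close>
  then obtain j where j: "Suc (Suc n) = k + 2 * j"
    by (metis dvdE le_add_diff_inverse)
  have x: "coeff (coeff (xv * p) k) j = (if k = 0 then 0 else coeff (coeff p (k - 1)) j)"
    for p :: "'a xsring"
    by (simp add: xv_def coeff_pCons split: nat.split)
  have s: "coeff (coeff (sv * emb r * p) k) j = (if j = 0 then 0 else r * coeff (coeff p k) (j - 1))"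
    for r and p :: "'a xsring"
    by (simp add: sv_def emb_def coeff_pCons split: nat.split)
  have "(-1) ^ j * b_coeff (Suc (Suc n)) k = coeff (coeff (cont_q_hermite (Suc (Suc n)) :: 'a xsring) k) j"
    by (simp add: coeff_cont_q_hermite j)
  also have "\<dots> = (if k = 0 then 0 else coeff (coeff (cont_q_hermite (Suc n)) (k - 1)) j)
      - (if j = 0 then 0 else qint (Suc n) * coeff (coeff (cont_q_hermite n) k) (j - 1))"
    by (simp only: cont_q_hermite.simps coeff_diff x s)
  also have "\<dots> = (-1) ^ j * ((if k = 0 then 0 else b_coeff (Suc n) (k - 1))
      + qint (Suc n) * b_coeff n k)"
  proof -
    have "(if k = 0 then 0 else coeff (coeff (cont_q_hermite (Suc n)) (k - 1)) j)
        = (-1) ^ j * (if k = 0 then 0 else b_coeff (Suc n) (k - 1) :: 'a qfield)"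
      using j by (auto simp: coeff_cont_q_hermite)
    moreover have "(if j = 0 then 0 else qint (Suc n) * coeff (coeff (cont_q_hermite n) k) (j - 1))
        = - ((-1) ^ j * (qint (Suc n) * b_coeff n k :: 'a qfield))"
      using j by (cases j) (auto simp: coeff_cont_q_hermite b_coeff_eq_0)
    ultimately show ?thesis by (simp add: algebra_simps)
  qed
  finally show ?thesis by simp
next
  case False
  then have "\<not> (k \<le> n \<and> even (n - k))" "k \<noteq> 0 \<Longrightarrow> \<not> (k - 1 \<le> Suc n \<and> even (Suc n - (k - 1)))"
    by (auto simp: Suc_diff_le)
  with False show ?thesis by (simp add: b_coeff_eq_0)
qed

definition signed_b :: "nat \<Rightarrow> nat \<Rightarrow> 'a::field qfield" where
  "signed_b n k = b_coeff n k * (-1) ^ ((n - k) div 2)"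

lemma signed_b_eq_0: "\<not> (k \<le> n \<and> even (n - k)) \<Longrightarrow> signed_b n k = 0"
  by (simp add: signed_b_def b_coeff_eq_0)

lemma signed_b_Suc_Suc:
  "signed_b (Suc (Suc n)) k
     = (if k = 0 then 0 else signed_b (Suc n) (k - 1)) - qint (Suc n) * (signed_b n k :: 'a::field qfield)"
proof (cases "k \<le> n")
  case True
  then have "(Suc (Suc n) - k) div 2 = Suc ((n - k) div 2)"
    by (simp add: Suc_diff_le)
  moreover from True have "k \<noteq> 0 \<Longrightarrow> Suc n - (k - 1) = Suc (Suc n) - k" by simp
  ultimately show ?thesis
    by (simp add: signed_b_def b_coeff_Suc_Suc algebra_simps)
next
  case False
  then show ?thesis by (cases k) (auto simp: signed_b_def b_coeff_Suc_Suc b_coeff_eq_0)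
qed

text \<open>
  The powers of \<open>-s\<close> keep this in the format of the expansions that define \<open>b\<close> and \<open>c\<close>; trading
  \<open>s\<close> for \<open>-s\<close> is what puts the sign into the second matrix.
\<close>

lemma coeff_P_at_0:
  "coeff (P_at_0 n) k = (emb (signed_b n k) * (- sv) ^ ((n - k) div 2) :: 'a::field xsring)"
proof (induction n arbitrary: k rule: P_at_0.induct)
  case 1
  show ?case by (simp add: signed_b_def b_coeff_0 emb_0 emb_1)
next
  case 2
  show ?case
    by (auto simp: signed_b_def b_coeff_1 emb_0 emb_1 zv_def coeff_pCons split: nat.split)
next
  case (3 n)
  have z: "coeff (zv * p) k = (if k = 0 then 0 else coeff p (k - 1))" for p :: "'a xsring poly"
    by (simp add: zv_def coeff_pCons split: nat.split)
  have shift: "(if k = 0 then 0 else coeff (P_at_0 (Suc n)) (k - 1))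
      = emb (if k = 0 then 0 else signed_b (Suc n) (k - 1)) * (- sv :: 'a xsring) ^ ((Suc (Suc n) - k) div 2)"
    by (cases k) (simp_all add: 3 emb_0)
  have lower: "sv * emb (qint (Suc n)) * coeff (P_at_0 n) k
      = - (emb (qint (Suc n) * signed_b n k) * (- sv :: 'a xsring) ^ ((Suc (Suc n) - k) div 2))"
  proof (cases "k \<le> n")
    case True
    then have "(Suc (Suc n) - k) div 2 = Suc ((n - k) div 2)"
      by (simp add: Suc_diff_le)
    then show ?thesis by (simp add: 3 emb_mult mult_ac)
  next
    case False
    then show ?thesis by (simp add: 3 signed_b_eq_0 emb_0)
  qed
  show ?case
    by (simp only: P_at_0.simps coeff_add coeff_smult z shift lower signed_b_Suc_Suc
        diff_conv_add_uminus emb_add emb_minus distrib_right mult_minus_left)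
qed

section \<open>Inversion\<close>

lemma new_q_hermite_inversion:
  "(\<Sum>k\<le>n. emb (signed_b n k) * (- sv) ^ ((n - k) div 2) * new_q_hermite k) = (xv ^ n :: 'a::field xsring)"
proof -
  have "degree (P_at_0 n :: 'a xsring poly) \<le> n"
    by (rule degree_le) (simp add: coeff_P_at_0 signed_b_eq_0 emb_0)
  then have "P_at_0 n = (\<Sum>k\<le>n. monom (coeff (P_at_0 n) k) k :: 'a xsring poly)"
    by (rule poly_as_sum_of_monoms'[symmetric])
  also have "\<dots> = (\<Sum>k\<le>n. smult (coeff (P_at_0 n) k) (zv ^ k))"
    by (simp add: zv_power smult_monom)
  finally have "functional (P_at_0 n)
      = (functional (\<Sum>k\<le>n. smult (coeff (P_at_0 n) k) (zv ^ k)) :: 'a xsring)"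
    by (rule arg_cong)
  also have "\<dots> = (\<Sum>k\<le>n. coeff (P_at_0 n) k * functional (zv ^ k))"
    by (rule functional_sum_smult)
  finally have "functional (P_at_0 n) = (\<Sum>k\<le>n. coeff (P_at_0 n) k * functional (zv ^ k) :: 'a xsring)" .
  then show ?thesis
    by (simp add: functional_P_at_0 coeff_P_at_0 new_q_hermite_def)
qed

lemma c_coeff_eq_0: "\<not> (k \<le> n \<and> even (n - k)) \<Longrightarrow> c_coeff n k = 0"
  using has_coeffs_c unfolding has_coeffs_def by blast

lemma new_q_hermite_expansion:
  assumes "k \<le> n"
  shows "new_q_hermite k
    = (\<Sum>m\<le>n. emb (c_coeff k m) * xv ^ m * (- sv) ^ ((k - m) div 2) :: 'a::field xsring)"
proof -
  have "(new_q_hermite k :: 'a xsring)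
      = (\<Sum>m | m \<le> k \<and> even (k - m). emb (c_coeff k m) * xv ^ m * (- sv) ^ ((k - m) div 2))"
    using has_coeffs_c unfolding has_coeffs_def by blast
  also have "\<dots> = (\<Sum>m\<le>n. emb (c_coeff k m) * xv ^ m * (- sv) ^ ((k - m) div 2))"
    using assms by (intro sum.mono_neutral_left) (auto simp: c_coeff_eq_0 emb_0)
  finally show ?thesis .
qed

text \<open>
  By homogeneity the powers of \<open>-s\<close> in the two expansions combine to one that depends only on the
  outer indices, so the entries of the matrix product appear as expansion coefficients of \<open>x\<^sup>n\<close>.
\<close>

lemma has_coeffs_product:
  "has_coeffs (\<lambda>n. xv ^ n) (\<lambda>n m. \<Sum>k\<le>n. signed_b n k * (c_coeff k m :: 'a::field qfield))"
proof -
  have zero: "signed_b n k * c_coeff k m = (0 :: 'a qfield)"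
    if "\<not> (m \<le> k \<and> k \<le> n \<and> even (n - k) \<and> even (k - m))" for n k m
    using that by (auto simp: signed_b_eq_0 c_coeff_eq_0)
  have vanish: "(\<Sum>k\<le>n. signed_b n k * c_coeff k m) = (0 :: 'a qfield)"
    if "\<not> (m \<le> n \<and> even (n - m))" for n m
  proof (intro sum.neutral ballI zero notI)
    fix k assume *: "m \<le> k \<and> k \<le> n \<and> even (n - k) \<and> even (k - m)"
    then have "even ((n - k) + (k - m))"
      by (intro dvd_add) blast+
    moreover from * have "(n - k) + (k - m) = n - m" "m \<le> n" by simp_all
    ultimately show False using that by metis
  qed
  have "xv ^ n = (\<Sum>m | m \<le> n \<and> even (n - m). emb (\<Sum>k\<le>n. signed_b n k * c_coeff k m)
      * xv ^ m * (- sv :: 'a xsring) ^ ((n - m) div 2))" (is "_ = ?R") for n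
  proof -
    have summand: "emb (signed_b n k) * (- sv) ^ ((n - k) div 2)
        * (emb (c_coeff k m) * xv ^ m * (- sv) ^ ((k - m) div 2))
        = emb (signed_b n k * c_coeff k m) * xv ^ m * (- sv :: 'a xsring) ^ ((n - m) div 2)"
      (is "?l = ?r") for k m
    proof (cases "m \<le> k \<and> k \<le> n \<and> even (n - k) \<and> even (k - m)")
      case True
      then have "(n - m) div 2 = ((n - k) + (k - m)) div 2"
        by simp
      also have "\<dots> = (n - k) div 2 + (k - m) div 2"
        using True by (intro div_plus_div_distrib_dvd_left) blast
      finally have "(n - m) div 2 = (n - k) div 2 + (k - m) div 2" .
      then show ?thesis by (simp add: emb_mult power_add mult_ac)
    next
      case False
      have "?l = emb (signed_b n k * c_coeff k m)
          * ((- sv) ^ ((n - k) div 2) * (xv ^ m * (- sv) ^ ((k - m) div 2)))"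
        by (simp add: emb_mult mult_ac)
      then show ?thesis by (simp only: zero[OF False] emb_0 mult_zero_left)
    qed
    have "xv ^ n = (\<Sum>k\<le>n. emb (signed_b n k) * (- sv :: 'a xsring) ^ ((n - k) div 2)
        * new_q_hermite k)"
      by (rule new_q_hermite_inversion[symmetric])
    also have "\<dots> = (\<Sum>k\<le>n. \<Sum>m\<le>n. emb (signed_b n k) * (- sv) ^ ((n - k) div 2)
        * (emb (c_coeff k m) * xv ^ m * (- sv) ^ ((k - m) div 2)))"
      unfolding sum_distrib_left[symmetric]
      by (intro sum.cong arg_cong2[where f = "(*)"] new_q_hermite_expansion) auto
    also have "\<dots> = (\<Sum>m\<le>n. emb (\<Sum>k\<le>n. signed_b n k * c_coeff k m)
        * xv ^ m * (- sv) ^ ((n - m) div 2))"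
      unfolding summand by (subst sum.swap) (simp only: emb_sum sum_distrib_right)
    also have "\<dots> = ?R"
      by (intro sum.mono_neutral_right) (auto simp: vanish emb_0)
    finally show ?thesis .
  qed
  with vanish show ?thesis unfolding has_coeffs_def by blast
qed

lemma has_coeffs_xv_power:
  "has_coeffs (\<lambda>n. xv ^ n) (\<lambda>n m. if n = m then 1 else 0 :: 'a::field qfield)"
proof -
  have "xv ^ n = (\<Sum>m | m \<le> n \<and> even (n - m). emb (if n = m then 1 else 0)
      * xv ^ m * (- sv :: 'a xsring) ^ ((n - m) div 2))" for n
  proof -
    have "(\<Sum>m | m \<le> n \<and> even (n - m). emb (if n = m then 1 else 0)
        * xv ^ m * (- sv :: 'a xsring) ^ ((n - m) div 2))
        = (\<Sum>m | m \<le> n \<and> even (n - m). if n = m then xv ^ m else 0)"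
      by (intro sum.cong) (auto simp: emb_0 emb_1)
    then show ?thesis by simp
  qed
  moreover have "(if n = m then 1 else 0) = (0 :: 'a qfield)" if "\<not> (m \<le> n \<and> even (n - m))" for n m :: nat
    using that by auto
  ultimately show ?thesis unfolding has_coeffs_def by blast
qed

lemma sum_signed_b_c_coeff:
  "(\<Sum>k\<le>n. signed_b n k * c_coeff k m) = (if n = m then 1 else 0 :: 'a::field qfield)"
proof -
  have hom: "homog n (xv ^ n :: 'a xsring)" for n
  proof (induction n)
    case (Suc n)
    then show ?case using homog_mult[OF homog_xv] by simp
  qed (simp add: homog_1)
  obtain a :: "nat \<Rightarrow> nat \<Rightarrow> 'a qfield"
    where a: "\<And>b. has_coeffs (\<lambda>n. xv ^ n) b \<Longrightarrow> b = a"
    using has_coeffs_ex1[OF hom] by (elim ex1E) blast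
  have "(\<lambda>n m. \<Sum>k\<le>n. signed_b n k * c_coeff k m) = (\<lambda>n m. if n = m then 1 else 0 :: 'a qfield)"
    by (rule trans[OF a[OF has_coeffs_product] a[OF has_coeffs_xv_power, symmetric]])
  then show ?thesis by (rule fun_cong[OF fun_cong])
qed

theorem theorem5:
  fixes n :: nat and C B :: "'a::field qfield mat"
  defines "C \<equiv> mat n n (\<lambda>(i, j). c_coeff i j)"
    and "B \<equiv> mat n n (\<lambda>(i, j). b_coeff i j * (-1) ^ ((i - j) div 2))"
  assumes "n \<ge> 1"
  shows "inverts_mat C B \<and> inverts_mat B C"
proof -
  have dims: "C \<in> carrier_mat n n" "B \<in> carrier_mat n n"
    by (simp_all add: C_def B_def)
  have BC: "B * C = 1\<^sub>m n"
  proof (rule eq_matI)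
    fix i j
    assume "i < dim_row (1\<^sub>m n :: 'a qfield mat)" "j < dim_col (1\<^sub>m n :: 'a qfield mat)"
    then have ij: "i < n" "j < n" by simp_all
    then have "(B * C) $$ (i, j) = (\<Sum>k<n. signed_b i k * c_coeff k j)"
      by (simp add: B_def C_def signed_b_def scalar_prod_def lessThan_atLeast0)
    also have "\<dots> = (\<Sum>k\<le>i. signed_b i k * c_coeff k j)"
      using ij by (intro sum.mono_neutral_right) (auto simp: signed_b_eq_0)
    finally show "(B * C) $$ (i, j) = 1\<^sub>m n $$ (i, j)"
      using ij by (simp add: sum_signed_b_c_coeff)
  qed (use dims in auto)
  have "C * B = 1\<^sub>m n"
    by (rule mat_mult_left_right_inverse[OF dims(2,1) BC])
  with BC dims show ?thesis by (auto simp: inverts_mat_def)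
qed

end
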